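(* Let $X_1, X_2, X_3$ be independent identically distributed random variables having a symmetric distribution. Suppose that $\varepsilon$ is a Bernoulli random variable taking the values $1$ and $0$ with equal probabilities, and that $\varepsilon$ is independent of $X_1, X_2, X_3$. Consider the two linear forms $$L_1 = \frac{X_1+X_2}{2} + \varepsilon X_3, \qquad L_2 = \frac{X_1-X_2}{2} + (1-\varepsilon) X_3.$$ The forms $L_1$ and $L_2$ are stochastically independent if and only if $X_1$ has a hyperbolic secant distribution.
   Context: The distribution of a real random variable $X$ is symmetric if $X$ and $-X$ have the same distribution. The standard hyperbolic secant distribution is the distribution on the real line with density $p(x) = \frac{1}{\pi}\cdot\frac{1}{\cosh(x)}$; its characteristic function is $f(t) = \frac{1}{\cosh(\pi t/2)}$. The term "hyperbolic secant distribution" is used for the general case with a scale parameter: $X$ has a hyperbolic secant distribution if for some $a>0$ its density is $\frac{1}{\pi a \cosh(x/a)}$, equivalently its characteristic function is $\frac{1}{\cosh(\pi a t/2)}$.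
   Formalization: The formal theorem additionally assumes that X_1 is not almost surely constant; this excludes exactly X_1 = 0 a.s., where L_1 = L_2 = 0 are independent but X_1 has no hyperbolic secant distribution. *)

theory Defs
  imports "HOL-Probability.Probability"
begin

definition symmetric_distribution :: "'a measure \<Rightarrow> ('a \<Rightarrow> real) \<Rightarrow> bool" where
  "symmetric_distribution M X \<longleftrightarrow>
     X \<in> borel_measurable M \<and> distr M borel X = distr M borel (\<lambda>\<omega>. - X \<omega>)"

definition nondegenerate :: "'a measure \<Rightarrow> ('a \<Rightarrow> real) \<Rightarrow> bool" where
  "nondegenerate M X \<longleftrightarrow> \<not> (\<exists>c. AE \<omega> in M. X \<omega> = c)"

text \<open>The values \<open>0\<close> and \<open>1\<close> are assumed almost surely only; this is implied by the
  two probabilities summing to \<open>1\<close>.\<close>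

definition fair_bernoulli :: "'a measure \<Rightarrow> ('a \<Rightarrow> real) \<Rightarrow> bool" where
  "fair_bernoulli M \<epsilon> \<longleftrightarrow> \<epsilon> \<in> borel_measurable M \<and>
     measure M {\<omega> \<in> space M. \<epsilon> \<omega> = 1} = 1 / 2 \<and>
     measure M {\<omega> \<in> space M. \<epsilon> \<omega> = 0} = 1 / 2"

definition hyperbolic_secant_density :: "real \<Rightarrow> real \<Rightarrow> real" where
  "hyperbolic_secant_density a x = 1 / (pi * a * cosh (x / a))"

definition hyperbolic_secant_distribution :: "'a measure \<Rightarrow> ('a \<Rightarrow> real) \<Rightarrow> bool" where
  "hyperbolic_secant_distribution M X \<longleftrightarrow>
     (\<exists>a>0. distributed M lborel X (\<lambda>x. ennreal (hyperbolic_secant_density a x)))"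

text \<open>The library's \<open>prob_space.indep_var\<close> only covers two random variables with values in
  the same type; here a real variable has to be independent of a random vector.\<close>

definition indep_rv ::
    "'a measure \<Rightarrow> 'b measure \<Rightarrow> ('a \<Rightarrow> 'b) \<Rightarrow> 'c measure \<Rightarrow> ('a \<Rightarrow> 'c) \<Rightarrow> bool" where
  "indep_rv M S X T Y \<longleftrightarrow> X \<in> measurable M S \<and> Y \<in> measurable M T \<and>
     prob_space.indep_set M {X -` A \<inter> space M | A. A \<in> sets S} {Y -` B \<inter> space M | B. B \<in> sets T}"

end

theory Submission
  imports Defs "HOL-Complex_Analysis.Residue_Theorem"
begin

text \<open>
  Let \<open>f\<close> be the characteristic function of \<open>X\<^sub>1\<close>. It is real and even by symmetry. Conditioning on
  \<open>\<epsilon>\<close>, the joint characteristic function of the two forms is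
  \<open>f ((s + t) / 2) f ((s - t) / 2) (f s + f t) / 2\<close> (\<open>char_random_linear_forms\<close>), and
  independence holds exactly if it is the product of its marginals
  (\<open>indep_var_if_char_factors\<close> for the harder direction). Thus independence is the
  functional equation

  \<open>f ((s + t) / 2) f ((s - t) / 2) (f s + f t) / 2 = f (s / 2)\<^sup>2 (1 + f s) / 2 \<cdot> f (t / 2)\<^sup>2 (1 + f t) / 2\<close>.

  Setting \<open>s = t\<close> shows first that \<open>f\<close> has no zeros, hence \<open>f > 0\<close>, and then
  \<open>f (s / 2)\<^sup>2 (1 + f s) / 2 = f s\<close>, the duplication formula of \<open>cosh\<close> for \<open>g = 1 / f\<close>. With it the
  full equation becomes d'Alembert's equation \<open>g (x + y) + g (x - y) = 2 g x g y\<close>. Since \<open>g\<close> is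
  continuous and at least \<open>1\<close>, its solutions are \<open>g x = cosh (c x)\<close>
  (\<open>dAlembert_ge_1_imp_cosh\<close>), where \<open>c = 0\<close> belongs to a degenerate \<open>X\<^sub>1\<close>. Conversely every
  such \<open>f = 1 / g\<close> solves the equation, by the addition theorem for \<open>cosh\<close>.

  The functions \<open>1 / cosh (c t)\<close> with \<open>c > 0\<close> are precisely the characteristic functions of the
  hyperbolic secant distributions: the Fourier transform of \<open>1 / cosh\<close> is computed with the
  residue theorem on a rectangle of height \<open>\<pi>\<close> (\<open>sech_Fourier_transform\<close>), and Levy's uniqueness
  theorem identifies the law (\<open>hyperbolic_secant_distribution_iff_char\<close>).
\<close>

section \<open>Independence and characteristic functions\<close>

lemma Int_stable_vimage: "Int_stable {X -` A \<inter> S |A. A \<in> sets N}"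
proof (rule Int_stableI, safe)
  fix A B assume "A \<in> sets N" "B \<in> sets N"
  then show "\<exists>C. X -` A \<inter> S \<inter> (X -` B \<inter> S) = X -` C \<inter> S \<and> C \<in> sets N"
    by (intro exI[of _ "A \<inter> B"]) auto
qed

text \<open>
  The predicate \<^const>\<open>indep_rv\<close> relates variables with values in different types; postcomposition
  with maps into a common type makes the product rule for expectations applicable.
\<close>

lemma (in prob_space) indep_rv_compose:
  assumes indep: "indep_rv M S X T Y"
    and f [measurable]: "f \<in> measurable S U" and g [measurable]: "g \<in> measurable T V"
  shows "indep_var U (\<lambda>\<omega>. f (X \<omega>)) V (\<lambda>\<omega>. g (Y \<omega>))"
proof -
  have [measurable]: "X \<in> measurable M S" "Y \<in> measurable M T"
    and ind: "indep_set {X -` A \<inter> space M |A. A \<in> sets S} {Y -` B \<inter> space M |B. B \<in> sets T}"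
    using indep by (auto simp: indep_rv_def)
  have "indep_set {(\<lambda>\<omega>. f (X \<omega>)) -` A \<inter> space M |A. A \<in> sets U}
                  {(\<lambda>\<omega>. g (Y \<omega>)) -` B \<inter> space M |B. B \<in> sets V}"
  proof (rule indep_setI, safe)
    fix A B assume A: "A \<in> sets U" and B: "B \<in> sets V"
    have eq_X: "(\<lambda>\<omega>. f (X \<omega>)) -` A \<inter> space M = X -` (f -` A \<inter> space S) \<inter> space M"
      by (auto dest: measurable_space[OF \<open>X \<in> measurable M S\<close>])
    have eq_Y: "(\<lambda>\<omega>. g (Y \<omega>)) -` B \<inter> space M = Y -` (g -` B \<inter> space T) \<inter> space M"
      by (auto dest: measurable_space[OF \<open>Y \<in> measurable M T\<close>])
    have "f -` A \<inter> space S \<in> sets S" "g -` B \<inter> space T \<in> sets T"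
      using A B by auto
    then show "prob ((\<lambda>\<omega>. f (X \<omega>)) -` A \<inter> space M \<inter> ((\<lambda>\<omega>. g (Y \<omega>)) -` B \<inter> space M)) =
        prob ((\<lambda>\<omega>. f (X \<omega>)) -` A \<inter> space M) * prob ((\<lambda>\<omega>. g (Y \<omega>)) -` B \<inter> space M)"
      unfolding eq_X eq_Y by (intro indep_setD[OF ind]) blast+
  qed auto
  then show ?thesis
    unfolding indep_var_eq by (auto intro!: indep_set_sigma_sets Int_stable_vimage)
qed

text \<open>
  For a nonnegative weight that factors out of every \<^term>\<open>iexp (s * X \<omega>)\<close>, one-dimensional
  uniqueness of characteristic functions, applied to \<^term>\<open>X\<close> under the weighted and the
  original probability, lets the weight factor out of indicators of events of \<^term>\<open>X\<close> as well.
\<close>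

lemma (in prob_space) expectation_weight_times_indicator:
  fixes W X :: "'a \<Rightarrow> real"
  assumes X [measurable]: "X \<in> borel_measurable M"
    and W: "integrable M W" "\<And>\<omega>. 0 \<le> W \<omega>"
    and fact: "\<And>s. (\<integral>\<omega>. W \<omega> *\<^sub>R iexp (s * X \<omega>) \<partial>M) = (\<integral>\<omega>. W \<omega> \<partial>M) *\<^sub>R (\<integral>\<omega>. iexp (s * X \<omega>) \<partial>M)"
    and A [measurable]: "A \<in> sets borel"
  shows "(\<integral>\<omega>. W \<omega> * indicator A (X \<omega>) \<partial>M) = (\<integral>\<omega>. W \<omega> \<partial>M) * prob (X -` A \<inter> space M)"
proof (cases "(\<integral>\<omega>. W \<omega> \<partial>M) = 0")
  case True
  have "AE \<omega> in M. W \<omega> = 0"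
    using True W integral_nonneg_eq_0_iff_AE[OF W(1)] by auto
  then have "(\<integral>\<omega>. W \<omega> * indicator A (X \<omega>) \<partial>M) = 0"
    by (intro integral_eq_zero_AE) auto
  with True show ?thesis by simp
next
  case False
  define c where "c = (\<integral>\<omega>. W \<omega> \<partial>M)"
  have c: "c > 0"
    using False W unfolding c_def by (simp add: order_less_le)
  have [measurable]: "W \<in> borel_measurable M"
    using W(1) by auto
  \<comment> \<open>Tilting the probability by the normalised weight leaves the characteristic function of
    \<^term>\<open>X\<close> unchanged, hence also its law.\<close>
  define N where "N = density M (\<lambda>\<omega>. ennreal (W \<omega> / c))"
  have [measurable_cong, simp]: "sets N = sets M" by (simp add: N_def)
  have spN [simp]: "space N = space M" by (simp add: N_def)
  have int_N: "integral\<^sup>L N f = (\<integral>\<omega>. (W \<omega> / c) *\<^sub>R f \<omega> \<partial>M)"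
    if "f \<in> borel_measurable M" for f :: "'a \<Rightarrow> 'b :: {banach, second_countable_topology}"
    unfolding N_def using c W(2) that by (subst integral_density) auto
  interpret N: prob_space N
  proof
    have "emeasure N (space N) = (\<integral>\<^sup>+\<omega>. ennreal (W \<omega> / c) \<partial>M)"
      by (simp add: N_def emeasure_density cong: nn_integral_cong)
    also have "\<dots> = ennreal (\<integral>\<omega>. W \<omega> / c \<partial>M)"
      using W c by (intro nn_integral_eq_integral) auto
    also have "\<dots> = 1"
      using c by (simp add: c_def)
    finally show "emeasure N (space N) = 1" .
  qed
  have "distr N borel X = distr M borel X"
  proof (rule Levy_uniqueness)
    show "real_distribution (distr N borel X)"
      by (rule N.real_distribution_distr) measurable
    show "real_distribution (distr M borel X)"
      by (rule real_distribution_distr) measurable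
    show "char (distr N borel X) = char (distr M borel X)"
    proof
      fix s
      have "char (distr N borel X) s = (\<integral>\<omega>. iexp (s * X \<omega>) \<partial>N)"
        unfolding char_def by (subst integral_distr) auto
      also have "\<dots> = (\<integral>\<omega>. (1 / c) *\<^sub>R (W \<omega> *\<^sub>R iexp (s * X \<omega>)) \<partial>M)"
        by (subst int_N) (auto simp: field_simps)
      also have "\<dots> = (1 / c) *\<^sub>R (\<integral>\<omega>. W \<omega> *\<^sub>R iexp (s * X \<omega>) \<partial>M)"
        by (rule integral_scaleR_right)
      also have "\<dots> = (\<integral>\<omega>. iexp (s * X \<omega>) \<partial>M)"
        using c unfolding fact by (simp flip: c_def)
      also have "\<dots> = char (distr M borel X) s"
        unfolding char_def by (subst integral_distr) auto
      finally show "char (distr N borel X) s = char (distr M borel X) s" .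
    qed
  qed
  then have "prob (X -` A \<inter> space M) = measure (distr N borel X) A"
    by (simp add: measure_distr)
  also have "\<dots> = (\<integral>\<omega>. indicator (X -` A \<inter> space M) \<omega> \<partial>N)"
    by (simp add: measure_distr)
  also have "\<dots> = (\<integral>\<omega>. (1 / c) * (W \<omega> * indicator A (X \<omega>)) \<partial>M)"
    by (subst int_N) (auto intro!: Bochner_Integration.integral_cong simp: indicator_def)
  also have "\<dots> = (1 / c) * (\<integral>\<omega>. W \<omega> * indicator A (X \<omega>) \<partial>M)"
    by (rule integral_mult_right_zero)
  finally have "(\<integral>\<omega>. W \<omega> * indicator A (X \<omega>) \<partial>M) = c * prob (X -` A \<inter> space M)"
    using c by simp
  then show ?thesis
    unfolding c_def .
qed

text \<open>
  Kac's criterion. Planar uniqueness of characteristic functions is replaced by two applications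
  of the preceding lemma: with the weights \<open>1 + cos (t Y + \<theta>)\<close> it exchanges the
  exponentials of \<^term>\<open>X\<close> for indicators of events of \<^term>\<open>X\<close>, and with
  these indicators as weights it does the same for \<^term>\<open>Y\<close>.
\<close>

lemma (in prob_space) indep_var_if_char_factors:
  fixes X Y :: "'a \<Rightarrow> real"
  assumes X [measurable]: "X \<in> borel_measurable M" and Y [measurable]: "Y \<in> borel_measurable M"
    and fact: "\<And>s t. (\<integral>\<omega>. iexp (s * X \<omega> + t * Y \<omega>) \<partial>M)
      = (\<integral>\<omega>. iexp (s * X \<omega>) \<partial>M) * (\<integral>\<omega>. iexp (t * Y \<omega>) \<partial>M)"
  shows "indep_var borel X borel Y"
proof -
  have int_iexp [simp]: "integrable M (\<lambda>\<omega>. iexp (f \<omega>))" if [measurable]: "f \<in> borel_measurable M" for f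
    by (rule integrable_const_bound[where B = 1]) auto
  have int_bdd: "integrable M f" if [measurable]: "f \<in> borel_measurable M" and "\<And>\<omega>. norm (f \<omega>) \<le> 2"
    for f :: "'a \<Rightarrow> real"
    using that by (intro integrable_const_bound[where B = 2]) auto
  have cos_iexp: "complex_of_real (cos a) = (iexp a + iexp (- a)) / 2" for a
    by (simp add: cos_of_real flip: cos_exp_eq)
  \<comment> \<open>The phase \<open>\<theta>\<close> covers cosine and sine together; the summand \<open>1\<close> added below makes
    the weight nonnegative.\<close>
  have cos_ind: "(\<integral>\<omega>. cos (t * Y \<omega> + \<theta>) * indicator A (X \<omega>) \<partial>M)
      = (\<integral>\<omega>. cos (t * Y \<omega> + \<theta>) \<partial>M) * prob (X -` A \<inter> space M)"
    if A [measurable]: "A \<in> sets borel" for t \<theta> A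
  proof -
    have char_cos: "(\<integral>\<omega>. cos (t * Y \<omega> + \<theta>) *\<^sub>R iexp (s * X \<omega>) \<partial>M)
        = (\<integral>\<omega>. cos (t * Y \<omega> + \<theta>) \<partial>M) *\<^sub>R (\<integral>\<omega>. iexp (s * X \<omega>) \<partial>M)" for s
    proof -
      have split: "cos (t * Y \<omega> + \<theta>) *\<^sub>R iexp (s * X \<omega>)
          = (iexp \<theta> / 2) * iexp (s * X \<omega> + t * Y \<omega>) + (iexp (- \<theta>) / 2) * iexp (s * X \<omega> + (- t) * Y \<omega>)" for \<omega> s
        unfolding scaleR_conv_of_real cos_iexp
        by (simp add: field_simps flip: exp_add)
      have eq: "(\<integral>\<omega>. cos (t * Y \<omega> + \<theta>) *\<^sub>R iexp (s * X \<omega>) \<partial>M)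
          = ((iexp \<theta> / 2) * (\<integral>\<omega>. iexp (t * Y \<omega>) \<partial>M) + (iexp (- \<theta>) / 2) * (\<integral>\<omega>. iexp ((- t) * Y \<omega>) \<partial>M))
             * (\<integral>\<omega>. iexp (s * X \<omega>) \<partial>M)" for s
        unfolding split
        by (subst Bochner_Integration.integral_add)
           (auto simp only: fact integral_mult_right_zero intro!: integrable_mult_right int_iexp, auto simp: algebra_simps)
      have "complex_of_real (\<integral>\<omega>. cos (t * Y \<omega> + \<theta>) \<partial>M)
          = (iexp \<theta> / 2) * (\<integral>\<omega>. iexp (t * Y \<omega>) \<partial>M) + (iexp (- \<theta>) / 2) * (\<integral>\<omega>. iexp ((- t) * Y \<omega>) \<partial>M)"
        using eq[of 0] by (simp add: scaleR_conv_of_real prob_space)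
      then show ?thesis
        unfolding eq[of s] by (simp add: scaleR_conv_of_real)
    qed
    have int_cos: "integrable M (\<lambda>\<omega>. cos (t * Y \<omega> + \<theta>))"
      by (rule int_bdd) (auto intro: order_trans[OF abs_cos_le_one])
    have int_cos_ind: "integrable M (\<lambda>\<omega>. cos (t * Y \<omega> + \<theta>) * indicator A (X \<omega>))"
      by (rule int_bdd) (auto simp: indicator_def intro: order_trans[OF abs_cos_le_one])
    have int_ind: "integrable M (\<lambda>\<omega>. indicator A (X \<omega>) :: real)"
      by (rule int_bdd) (auto simp: indicator_def)
    have ind: "(\<integral>\<omega>. indicator A (X \<omega>) \<partial>M) = prob (X -` A \<inter> space M)"
    proof -
      have "(\<integral>\<omega>. indicator A (X \<omega>) \<partial>M) = (\<integral>\<omega>. indicator (X -` A \<inter> space M) \<omega> \<partial>M :: real)"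
        by (intro Bochner_Integration.integral_cong) (auto simp: indicator_def)
      then show ?thesis by simp
    qed
    have "(\<integral>\<omega>. (1 + cos (t * Y \<omega> + \<theta>)) * indicator A (X \<omega>) \<partial>M)
        = (\<integral>\<omega>. 1 + cos (t * Y \<omega> + \<theta>) \<partial>M) * prob (X -` A \<inter> space M)"
    proof (rule expectation_weight_times_indicator)
      show "0 \<le> 1 + cos (t * Y \<omega> + \<theta>)" for \<omega>
        using cos_ge_minus_one[of "t * Y \<omega> + \<theta>"] by linarith
      show "(\<integral>\<omega>. (1 + cos (t * Y \<omega> + \<theta>)) *\<^sub>R iexp (s * X \<omega>) \<partial>M)
        = (\<integral>\<omega>. 1 + cos (t * Y \<omega> + \<theta>) \<partial>M) *\<^sub>R (\<integral>\<omega>. iexp (s * X \<omega>) \<partial>M)" for s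
      proof -
        have "integrable M (\<lambda>\<omega>. cos (t * Y \<omega> + \<theta>) *\<^sub>R iexp (s * X \<omega>))"
          by (rule integrable_const_bound[where B = 1]) auto
        then have "(\<integral>\<omega>. (1 + cos (t * Y \<omega> + \<theta>)) *\<^sub>R iexp (s * X \<omega>) \<partial>M)
          = (\<integral>\<omega>. iexp (s * X \<omega>) \<partial>M) + (\<integral>\<omega>. cos (t * Y \<omega> + \<theta>) *\<^sub>R iexp (s * X \<omega>) \<partial>M)"
          unfolding scaleR_add_left scaleR_one
          by (intro Bochner_Integration.integral_add int_iexp) auto
        also have "\<dots> = (\<integral>\<omega>. iexp (s * X \<omega>) \<partial>M)
            + (\<integral>\<omega>. cos (t * Y \<omega> + \<theta>) \<partial>M) *\<^sub>R (\<integral>\<omega>. iexp (s * X \<omega>) \<partial>M)"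
          unfolding char_cos ..
        also have "\<dots> = (\<integral>\<omega>. 1 + cos (t * Y \<omega> + \<theta>) \<partial>M) *\<^sub>R (\<integral>\<omega>. iexp (s * X \<omega>) \<partial>M)"
          using int_cos by (simp add: scaleR_add_left prob_space)
        finally show ?thesis .
      qed
    qed (use int_cos in auto)
    then show ?thesis
      using int_cos int_cos_ind int_ind by (simp add: distrib_right ind prob_space)
  qed
  have joint: "prob ((X -` A \<inter> space M) \<inter> (Y -` B \<inter> space M)) = prob (X -` A \<inter> space M) * prob (Y -` B \<inter> space M)"
    if A [measurable]: "A \<in> sets borel" and B [measurable]: "B \<in> sets borel" for A B
  proof -
    let ?I = "\<lambda>\<omega>. indicator A (X \<omega>) :: real"
    have ind: "(\<integral>\<omega>. ?I \<omega> \<partial>M) = prob (X -` A \<inter> space M)"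
      using cos_ind[OF A, of 0 0] by (simp add: prob_space)
    have int_I: "integrable M ?I"
      by (rule int_bdd) (auto simp: indicator_def)
    have iexp_eq: "iexp a = of_real (cos a) + \<i> * of_real (cos (a + (- pi / 2)))" for a
      by (simp add: cos_diff exp_Euler cos_of_real sin_of_real)
    have "(\<integral>\<omega>. ?I \<omega> * indicator B (Y \<omega>) \<partial>M) = (\<integral>\<omega>. ?I \<omega> \<partial>M) * prob (Y -` B \<inter> space M)"
    proof (rule expectation_weight_times_indicator)
      fix t
      have int1: "integrable M (\<lambda>\<omega>. cos (t * Y \<omega> + \<theta>) * ?I \<omega>)" for \<theta>
        by (rule int_bdd) (auto simp: indicator_def intro: order_trans[OF abs_cos_le_one])
      have int2: "integrable M (\<lambda>\<omega>. cos (t * Y \<omega> + \<theta>))" for \<theta>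
        by (rule int_bdd) (auto intro: order_trans[OF abs_cos_le_one])
      have "(\<integral>\<omega>. ?I \<omega> *\<^sub>R iexp (t * Y \<omega>) \<partial>M)
        = (\<integral>\<omega>. complex_of_real (cos (t * Y \<omega> + 0) * ?I \<omega>)
            + \<i> * complex_of_real (cos (t * Y \<omega> + (- pi / 2)) * ?I \<omega>) \<partial>M)"
        by (intro Bochner_Integration.integral_cong refl, unfold iexp_eq) (simp add: scaleR_conv_of_real algebra_simps)
      also have "\<dots> = complex_of_real (\<integral>\<omega>. cos (t * Y \<omega> + 0) * ?I \<omega> \<partial>M)
            + \<i> * complex_of_real (\<integral>\<omega>. cos (t * Y \<omega> + (- pi / 2)) * ?I \<omega> \<partial>M)"
        by (subst Bochner_Integration.integral_add)
           (auto simp only: integral_mult_right_zero integral_complex_of_real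
              intro!: integrable_mult_right integrable_of_real int1)
      also have "\<dots> = prob (X -` A \<inter> space M) *\<^sub>R
          (complex_of_real (\<integral>\<omega>. cos (t * Y \<omega> + 0) \<partial>M) + \<i> * complex_of_real (\<integral>\<omega>. cos (t * Y \<omega> + (- pi / 2)) \<partial>M))"
        unfolding cos_ind[OF A] by (simp add: scaleR_conv_of_real algebra_simps)
      also have "complex_of_real (\<integral>\<omega>. cos (t * Y \<omega> + 0) \<partial>M) + \<i> * complex_of_real (\<integral>\<omega>. cos (t * Y \<omega> + (- pi / 2)) \<partial>M)
          = (\<integral>\<omega>. complex_of_real (cos (t * Y \<omega> + 0)) + \<i> * complex_of_real (cos (t * Y \<omega> + (- pi / 2))) \<partial>M)"
        by (subst Bochner_Integration.integral_add)
           (auto simp only: integral_mult_right_zero integral_complex_of_real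
              intro!: integrable_mult_right integrable_of_real int2)
      also have "\<dots> = (\<integral>\<omega>. iexp (t * Y \<omega>) \<partial>M)"
        by (simp only: iexp_eq add_0_right)
      finally show "(\<integral>\<omega>. ?I \<omega> *\<^sub>R iexp (t * Y \<omega>) \<partial>M) = (\<integral>\<omega>. ?I \<omega> \<partial>M) *\<^sub>R (\<integral>\<omega>. iexp (t * Y \<omega>) \<partial>M)"
        unfolding ind .
    qed (use int_I in auto)
    moreover have "(\<integral>\<omega>. ?I \<omega> * indicator B (Y \<omega>) \<partial>M)
        = (\<integral>\<omega>. indicator ((X -` A \<inter> space M) \<inter> (Y -` B \<inter> space M)) \<omega> \<partial>M)"
      by (intro Bochner_Integration.integral_cong) (auto simp: indicator_def)
    ultimately show ?thesis
      by (simp add: ind)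
  qed
  have "indep_set {X -` A \<inter> space M |A. A \<in> sets borel} {Y -` A \<inter> space M |A. A \<in> sets borel}"
    using joint by (intro indep_setI) auto
  then show ?thesis
    unfolding indep_var_eq by (auto intro!: indep_set_sigma_sets Int_stable_vimage)
qed

lemma (in prob_space) char_eq_expectation:
  assumes "X \<in> borel_measurable M"
  shows "char (distr M borel X) t = (\<integral>\<omega>. iexp (t * X \<omega>) \<partial>M)"
  unfolding char_def using assms by (subst integral_distr) auto

lemma (in prob_space) char_symmetric:
  assumes "symmetric_distribution M X"
  shows "char (distr M borel X) t = complex_of_real (\<integral>\<omega>. cos (t * X \<omega>) \<partial>M)"
proof -
  have [measurable]: "X \<in> borel_measurable M"
    and sym: "distr M borel X = distr M borel (\<lambda>\<omega>. - X \<omega>)"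
    using assms by (auto simp: symmetric_distribution_def)
  have int: "integrable M (\<lambda>\<omega>. iexp (t * X \<omega>))"
    by (rule integrable_const_bound[where B = 1]) auto
  have "char (distr M borel X) t = cnj (char (distr M borel X) t)"
  proof -
    have "char (distr M borel X) t = (\<integral>\<omega>. iexp (t * - X \<omega>) \<partial>M)"
      by (subst sym, subst char_eq_expectation) auto
    also have "\<dots> = (\<integral>\<omega>. cnj (iexp (t * X \<omega>)) \<partial>M)"
      by (simp add: exp_cnj)
    also have "\<dots> = cnj (char (distr M borel X) t)"
      by (subst char_eq_expectation) auto
    finally show ?thesis .
  qed
  then have "char (distr M borel X) t = complex_of_real (Re (char (distr M borel X) t))"
    by (simp add: complex_eq_iff)
  also have "Re (char (distr M borel X) t) = (\<integral>\<omega>. cos (t * X \<omega>) \<partial>M)"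
    using int by (subst char_eq_expectation) (auto simp: Re_exp simp flip: integral_Re)
  finally show ?thesis .
qed

section \<open>The functional equation and d'Alembert's equation\<close>

text \<open>
  On the diagonal \<open>s = t = u\<close> the equation sends a zero \<open>u\<close> of \<open>\<phi>\<close> to the zero
  \<open>u / 2\<close>, so zeros would accumulate at \<open>0\<close>, where \<open>\<phi>\<close> is \<open>1\<close>.
\<close>

lemma functional_equation_imp_pos:
  fixes \<phi> :: "real \<Rightarrow> real"
  assumes cont: "continuous_on UNIV \<phi>" and zero: "\<phi> 0 = 1"
    and eq: "\<And>s t. \<phi> ((s + t) / 2) * \<phi> ((s - t) / 2) * ((\<phi> s + \<phi> t) / 2)
      = (\<phi> (s / 2))\<^sup>2 * ((\<phi> s + 1) / 2) * ((\<phi> (t / 2))\<^sup>2 * ((\<phi> t + 1) / 2))"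
  shows "0 < \<phi> x"
proof (rule ccontr)
  assume "\<not> 0 < \<phi> x"
  have half: "\<phi> (u / 2) = 0" if "\<phi> u = 0" for u
    using eq[of u u] that zero by (auto simp: field_simps)
  have "\<exists>z. \<phi> z = 0"
  proof (cases "0 \<le> x")
    case True
    have "\<exists>z\<ge>0. z \<le> x \<and> \<phi> z = 0"
      by (rule IVT2') (use True \<open>\<not> 0 < \<phi> x\<close> zero cont continuous_on_subset in auto)
    then show ?thesis by blast
  next
    case False
    have "\<exists>z\<ge>x. z \<le> 0 \<and> \<phi> z = 0"
      by (rule IVT') (use False \<open>\<not> 0 < \<phi> x\<close> zero cont continuous_on_subset in auto)
    then show ?thesis by blast
  qed
  then obtain z where z: "\<phi> z = 0" by blast
  have zn: "\<phi> (z / 2 ^ n) = 0" for n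
  proof (induction n)
    case (Suc n)
    from half[OF this] show ?case by (simp add: field_simps)
  qed (simp add: z)
  have "(\<lambda>n. z / 2 ^ n) \<longlonglongrightarrow> 0"
    using LIMSEQ_divide_realpow_zero[of 2 z] by simp
  moreover have "isCont \<phi> 0"
    using cont by (simp add: continuous_on_eq_continuous_at)
  ultimately have "(\<lambda>n. \<phi> (z / 2 ^ n)) \<longlonglongrightarrow> \<phi> 0"
    using isCont_tendsto_compose by blast
  then show False
    using zn zero by (simp add: LIMSEQ_const_iff)
qed

text \<open>
  The bound \<^term>\<open>1 \<le> g x\<close> selects the hyperbolic solutions of d'Alembert's equation and
  makes the half-argument formula unambiguous: \<^term>\<open>g 1\<close> fixes the values at \<open>1 / 2 ^ n\<close>,
  the equation propagates them to all dyadic rationals, and continuity does the rest.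
\<close>

lemma dAlembert_ge_1_imp_cosh:
  fixes g :: "real \<Rightarrow> real"
  assumes cont: "continuous_on UNIV g" and ge: "\<And>x. 1 \<le> g x"
    and dA: "\<And>x y. g (x + y) + g (x - y) = 2 * g x * g y"
  shows "\<exists>c\<ge>0. \<forall>x. g x = cosh (c * x)"
proof -
  have g0: "g 0 = 1"
    using dA[of 0 0] ge[of 0] by simp
  have even: "g (- x) = g x" for x
    using dA[of 0 x] g0 by simp
  define c where "c = arcosh (g 1)"
  have c: "c \<ge> 0" "cosh c = g 1"
    using ge[of 1] by (auto simp: c_def)
  have pow: "g (1 / 2 ^ n) = cosh (c / 2 ^ n)" for n
  proof (induction n)
    case (Suc n)
    have "2 * (g (1 / 2 ^ Suc n))\<^sup>2 = g (1 / 2 ^ n) + 1"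
      using dA[of "1 / 2 ^ Suc n" "1 / 2 ^ Suc n"] g0 by (simp add: power2_eq_square)
    also have "\<dots> = 2 * (cosh (c / 2 ^ Suc n))\<^sup>2"
      using cosh_double_cosh[of "c / 2 ^ Suc n"] Suc by simp
    finally show ?case
      using ge[of "1 / 2 ^ Suc n"] cosh_real_ge_1[of "c / 2 ^ Suc n"] by (simp add: power2_eq_iff_nonneg)
  qed (use c in auto)
  have mult: "g (real k / 2 ^ n) = cosh (c * (real k / 2 ^ n)) \<and> g (real (Suc k) / 2 ^ n) = cosh (c * (real (Suc k) / 2 ^ n))" for k n
  proof (induction k)
    case 0
    then show ?case using pow[of n] g0 by simp
  next
    case (Suc k)
    define h :: real where "h = 1 / 2 ^ n"
    have "g (real (Suc k) * h + h) + g (real (Suc k) * h - h) = 2 * g (real (Suc k) * h) * g h"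
      by (rule dA)
    moreover have "cosh (c * (real (Suc k) * h) + c * h) + cosh (c * (real (Suc k) * h) - c * h)
        = 2 * cosh (c * (real (Suc k) * h)) * cosh (c * h)"
      by (simp add: cosh_add cosh_diff)
    moreover have "real (Suc k) * h + h = real (Suc (Suc k)) / 2 ^ n" "real (Suc k) * h - h = real k / 2 ^ n"
        "real (Suc k) * h = real (Suc k) / 2 ^ n"
      by (simp_all add: h_def add_divide_distrib)
    moreover have "c * (real (Suc k) * h) + c * h = c * (real (Suc k) * h + h)"
        "c * (real (Suc k) * h) - c * h = c * (real (Suc k) * h - h)"
      by (simp_all only: distrib_left right_diff_distrib)
    moreover have "g h = cosh (c * h)"
      using pow[of n] by (simp add: h_def)
    ultimately show ?case
      using Suc by (metis add_right_cancel)
  qed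
  have eq: "g x = cosh (c * x)" if "x \<ge> 0" for x
  proof -
    have lim: "(\<lambda>n. real (nat \<lfloor>2 ^ n * x\<rfloor>) / 2 ^ n) \<longlonglongrightarrow> x"
    proof (rule tendsto_sandwich)
      show "\<forall>\<^sub>F n in sequentially. x - 1 / 2 ^ n \<le> real (nat \<lfloor>2 ^ n * x\<rfloor>) / 2 ^ n"
      proof (intro always_eventually allI)
        fix n
        have "2 ^ n * x - 1 \<le> real (nat \<lfloor>2 ^ n * x\<rfloor>)" using that by linarith
        then have "(2 ^ n * x - 1) / 2 ^ n \<le> real (nat \<lfloor>2 ^ n * x\<rfloor>) / 2 ^ n"
          by (intro divide_right_mono) auto
        then show "x - 1 / 2 ^ n \<le> real (nat \<lfloor>2 ^ n * x\<rfloor>) / 2 ^ n"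
          by (simp add: diff_divide_distrib)
      qed
      show "\<forall>\<^sub>F n in sequentially. real (nat \<lfloor>2 ^ n * x\<rfloor>) / 2 ^ n \<le> x"
      proof (intro always_eventually allI)
        fix n
        have "real (nat \<lfloor>2 ^ n * x\<rfloor>) \<le> 2 ^ n * x" using that by simp
        then show "real (nat \<lfloor>2 ^ n * x\<rfloor>) / 2 ^ n \<le> x" by (simp add: field_simps)
      qed
      show "(\<lambda>n. x - 1 / 2 ^ n) \<longlonglongrightarrow> x"
        using tendsto_diff[OF tendsto_const LIMSEQ_divide_realpow_zero[of 2 1], of x] by simp
    qed simp
    have "isCont g x" using cont by (simp add: continuous_on_eq_continuous_at)
    then have "(\<lambda>n. g (real (nat \<lfloor>2 ^ n * x\<rfloor>) / 2 ^ n)) \<longlonglongrightarrow> g x"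
      using isCont_tendsto_compose lim by blast
    moreover have "(\<lambda>n. cosh (c * (real (nat \<lfloor>2 ^ n * x\<rfloor>) / 2 ^ n))) \<longlonglongrightarrow> cosh (c * x)"
      by (intro tendsto_intros lim)
    ultimately show ?thesis
      using mult LIMSEQ_unique by simp
  qed
  have "g x = cosh (c * x)" for x
    using eq[of x] eq[of "- x"] even[of x] by (cases "x \<ge> 0") auto
  with c show ?thesis by blast
qed

text \<open>
  The diagonal of the equation turns each factor on the right into \<open>\<phi> s\<close> and \<open>\<phi> t\<close>; what
  remains says that \<open>1 / \<phi>\<close> satisfies d'Alembert's equation.
\<close>

lemma functional_equation_imp_sech:
  fixes \<phi> :: "real \<Rightarrow> real"
  assumes cont: "continuous_on UNIV \<phi>" and zero: "\<phi> 0 = 1" and le: "\<And>x. \<phi> x \<le> 1"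
    and eq: "\<And>s t. \<phi> ((s + t) / 2) * \<phi> ((s - t) / 2) * ((\<phi> s + \<phi> t) / 2)
      = (\<phi> (s / 2))\<^sup>2 * ((\<phi> s + 1) / 2) * ((\<phi> (t / 2))\<^sup>2 * ((\<phi> t + 1) / 2))"
  shows "\<exists>c\<ge>0. \<forall>x. \<phi> x = 1 / cosh (c * x)"
proof -
  have pos: "0 < \<phi> x" for x
    using functional_equation_imp_pos[OF cont zero eq] .
  define g where "g x = 1 / \<phi> x" for x
  have phi: "\<phi> x = 1 / g x" for x by (simp add: g_def)
  have g_pos: "0 < g x" for x using pos by (simp add: g_def)
  have doubling: "(\<phi> u)\<^sup>2 * ((\<phi> (2 * u) + 1) / 2) = \<phi> (2 * u)" for u
  proof -
    have "(\<phi> (2 * u))\<^sup>2 = ((\<phi> u)\<^sup>2 * ((\<phi> (2 * u) + 1) / 2))\<^sup>2"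
      using eq[of "2 * u" "2 * u"] zero by (simp add: power2_eq_square)
    then show ?thesis
      using pos[of "2 * u"] by (subst (asm) power2_eq_iff_nonneg) auto
  qed
  have "\<exists>c\<ge>0. \<forall>x. g x = cosh (c * x)"
  proof (rule dAlembert_ge_1_imp_cosh)
    show "continuous_on UNIV g"
      unfolding g_def using pos by (intro continuous_intros cont) (metis less_irrefl)
    show "1 \<le> g x" for x
      using le[of x] pos[of x] by (simp add: g_def)
    have half_sum: "g (2 * x) + g (2 * y) = 2 * (g (x + y) * g (x - y))" for x y
    proof -
      have arg: "(2 * x + 2 * y) / 2 = x + y" "(2 * x - 2 * y) / 2 = x - y" "2 * x / 2 = x" "2 * y / 2 = y"
        by (simp_all add: field_simps)
      have quot: "a + b = 2 * (p * q)"
        if pos: "0 < p" "0 < q" "0 < a" "0 < b" and eq: "1 / p * (1 / q) * ((1 / a + 1 / b) / 2) = 1 / a * (1 / b)"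
        for p q a b :: real
      proof -
        have "1 / p * (1 / q) * ((1 / a + 1 / b) / 2) = 1 / a * (1 / b) * ((a + b) / (2 * (p * q)))"
          using pos by (simp add: field_simps)
        then have "1 / a * (1 / b) * ((a + b) / (2 * (p * q))) = 1 / a * (1 / b) * 1"
          using eq by simp
        then have "(a + b) / (2 * (p * q)) = 1"
          using pos by (subst (asm) mult_cancel_left) auto
        then show ?thesis by (simp add: divide_eq_1_iff)
      qed
      have "\<phi> (x + y) * \<phi> (x - y) * ((\<phi> (2 * x) + \<phi> (2 * y)) / 2) = \<phi> (2 * x) * \<phi> (2 * y)"
        using eq[of "2 * x" "2 * y"] unfolding arg doubling .
      then show ?thesis
        unfolding phi by (rule quot[OF g_pos g_pos g_pos g_pos])
    qed
    fix x y :: real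
    have "2 * ((x + y) / 2) = x + y" "2 * ((x - y) / 2) = x - y"
        "(x + y) / 2 + (x - y) / 2 = x" "(x + y) / 2 - (x - y) / 2 = y"
      by (simp_all add: field_simps)
    then show "g (x + y) + g (x - y) = 2 * g x * g y"
      using half_sum[of "(x + y) / 2" "(x - y) / 2"] by (simp only: mult.assoc)
  qed
  then show ?thesis by (auto simp: phi)
qed

section \<open>The Fourier transform of the hyperbolic secant\<close>

lemma integrable_sech: "integrable lborel (\<lambda>x::real. 1 / cosh x)"
proof -
  \<comment> \<open>A primitive is the Gudermannian function \<open>arctan (sinh x)\<close>, which is bounded.\<close>
  have "set_integrable lborel (einterval (-\<infinity>) \<infinity>) (\<lambda>x::real. 1 / cosh x)"
  proof (rule interval_integral_FTC_nonneg)
    fix x :: real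
    show "DERIV (\<lambda>x. arctan (sinh x)) x :> 1 / cosh x"
    proof (rule DERIV_cong)
      show "DERIV (\<lambda>x. arctan (sinh x)) x :> inverse (1 + (sinh x)\<^sup>2) * cosh x"
        by (auto intro!: derivative_eq_intros)
      show "inverse (1 + (sinh x)\<^sup>2) * cosh x = 1 / cosh x"
        unfolding add.commute[of 1] cosh_square_eq[symmetric]
        by (simp add: power2_eq_square divide_simps)
    qed
    show "isCont (\<lambda>x::real. 1 / cosh x) x"
      by (intro continuous_intros) auto
  next
    have "((\<lambda>x. arctan (sinh x)) \<longlongrightarrow> - (pi / 2)) at_bot"
      by (rule filterlim_compose[OF tendsto_arctan_at_bot sinh_real_at_bot])
    then show "(((\<lambda>x. arctan (sinh x)) \<circ> real_of_ereal) \<longlongrightarrow> - (pi / 2)) (at_right (- \<infinity>))"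
      by (simp add: ereal_tendsto_simps)
    have "((\<lambda>x. arctan (sinh x)) \<longlongrightarrow> pi / 2) at_top"
      by (rule filterlim_compose[OF tendsto_arctan_at_top sinh_real_at_top])
    then show "(((\<lambda>x. arctan (sinh x)) \<circ> real_of_ereal) \<longlongrightarrow> pi / 2) (at_left \<infinity>)"
      by (simp add: ereal_tendsto_simps)
  qed auto
  then show ?thesis
    by (simp add: set_integrable_def)
qed

lemma cosh_complex_eq_0_imp:
  fixes z :: complex
  assumes "cosh z = 0" and "- (pi / 2) < Im z" "Im z < 3 * pi / 2"
  shows "z = \<i> * (pi / 2)"
proof -
  have "exp z = - exp (- z)"
    using assms(1) by (simp add: cosh_field_def add_eq_0_iff2)
  then have "exp z * exp z = exp z * - exp (- z)"
    by (rule arg_cong)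
  also have "\<dots> = exp (\<i> * pi)"
    by (simp add: exp_minus_inverse)
  finally have "exp (2 * z) = exp (\<i> * pi)"
    by (simp only: mult_2 exp_add)
  then obtain n :: int where n: "2 * z = \<i> * pi + of_int (2 * n) * pi * \<i>"
    unfolding exp_eq by blast
  then have eq: "z = \<i> * (pi / 2) + of_int n * pi * \<i>"
    by (simp add: field_simps)
  then have "Im z = pi / 2 + n * pi"
    by simp
  with assms(2,3) have "pi * (-1) < pi * n" "pi * n < pi * 1"
    by (simp_all add: field_simps)
  then have "n = 0"
    by (subst (asm) (1 2) mult_less_cancel_left_pos) auto
  with eq show ?thesis by simp
qed

lemma norm_cosh_ge_sinh: "sinh \<bar>Re z\<bar> \<le> norm (cosh z)" for z :: complex
proof -
  have "norm (exp z + exp (- z)) \<ge> norm (exp z) - norm (exp (- z))"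
       "norm (exp z + exp (- z)) \<ge> norm (exp (- z)) - norm (exp z)"
    using norm_diff_ineq[of "exp z" "exp (- z)"] norm_diff_ineq[of "exp (- z)" "exp z"]
    by (simp_all add: add.commute)
  then show ?thesis
    by (simp add: cosh_field_def sinh_field_def norm_divide abs_if)
qed

text \<open>
  The integrand \<open>F z = exp (\<i> t z) / cosh z\<close> satisfies \<open>F (z + \<i> \<pi>) = - exp (- \<pi> t) F z\<close>, so on
  the rectangle with vertices \<open>\<plusminus> R\<close> and \<open>\<plusminus> R + \<i> \<pi>\<close> the upper side reproduces a multiple of the
  lower one. The only enclosed pole is \<open>\<i> \<pi> / 2\<close>, and \<open>\<bar>cosh z\<bar> \<ge> sinh R\<close> bounds the vertical
  sides.
\<close>

lemma sech_contour_integral: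
  fixes t R :: real
  assumes R: "R > 0"
  defines "F \<equiv> \<lambda>z. exp (\<i> * of_real t * z) / cosh z"
  shows "norm (contour_integral (linepath (- of_real R) (of_real R)) F * (1 + exp (- pi * t)) - 2 * pi * exp (- pi * t / 2))
    \<le> 2 * pi * exp (pi * \<bar>t\<bar>) / sinh R"
proof -
  define p where "p = \<i> * complex_of_real (pi / 2)"
  \<comment> \<open>An open strip that contains the rectangle and meets the zero set of \<open>cosh\<close> in \<open>p\<close> only.\<close>
  define S where "S = {z. - (pi / 2) < Im z \<and> Im z < 3 * pi / 2}"
  define a1 a2 a3 a4 where "a1 = - complex_of_real R" and "a2 = complex_of_real R"
    and "a3 = Complex R pi" and "a4 = Complex (- R) pi"
  note a_defs = a1_def a2_def a3_def a4_def
  have S_open: "open S" and S_convex: "convex S"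
  proof -
    have *: "S = {z. - (pi / 2) < Im z} \<inter> {z. Im z < 3 * pi / 2}"
      by (auto simp: S_def)
    show "open S" "convex S"
      unfolding * by (intro open_Int convex_Int open_halfspace_Im_gt open_halfspace_Im_lt
        convex_halfspace_Im_gt convex_halfspace_Im_lt)+
  qed
  have cosh_nz: "cosh z \<noteq> 0" if "z \<in> S - {p}" for z
    using cosh_complex_eq_0_imp[of z] that by (auto simp: S_def p_def)
  have num_holo: "(\<lambda>z. exp (\<i> * of_real t * z)) holomorphic_on A" for A
    by (intro holomorphic_intros)
  have cosh_holo: "(cosh :: complex \<Rightarrow> complex) holomorphic_on A" for A
    unfolding cosh_field_def[abs_def] by (intro holomorphic_intros) auto
  have F_holo: "F holomorphic_on S - {p}"
    unfolding F_def by (intro holomorphic_on_divide num_holo cosh_holo cosh_nz)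
  have in_S: "z \<in> S" if "0 \<le> Im z" "Im z \<le> pi" for z
    using that pi_gt_zero unfolding S_def mem_Collect_eq by linarith
  have path_im: "path_image (rectpath a1 a3) \<subseteq> S - {p}"
  proof
    fix z assume "z \<in> path_image (rectpath a1 a3)"
    then have "0 \<le> Im z" "Im z \<le> pi" "z \<noteq> p"
      using R by (auto simp: path_image_rectpath a_defs p_def complex_eq_iff)
    then show "z \<in> S - {p}"
      using in_S by simp
  qed
  have pS: "p \<in> S" using pi_gt_zero by (simp add: p_def S_def)
  have res: "residue F p = exp (- pi * t / 2) / \<i>"
  proof -
    have exp_p: "exp p = \<i>"
      unfolding p_def cis_conv_exp[symmetric] by simp
    then have exp_mp: "exp (- p) = - \<i>"
      by (simp add: exp_minus)
    have "residue F p = exp (\<i> * of_real t * p) / sinh p"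
      unfolding F_def
    proof (rule residue_simple_pole_deriv[OF num_holo cosh_holo S_open convex_connected[OF S_convex] pS])
      show "(cosh has_field_derivative sinh p) (at p)"
        by (auto intro!: derivative_eq_intros)
    qed (auto simp: cosh_field_def sinh_field_def exp_p exp_mp)
    also have "\<i> * of_real t * p = complex_of_real (- pi * t / 2)"
      by (simp add: p_def complex_eq_iff)
    finally show ?thesis
      by (simp add: sinh_field_def exp_p exp_mp flip: exp_of_real)
  qed
  have "contour_integral (rectpath a1 a3) F
      = 2 * pi * \<i> * (\<Sum>q\<in>{p}. winding_number (rectpath a1 a3) q * residue F q)"
  proof (rule Residue_theorem[OF S_open convex_connected[OF S_convex] _ F_holo])
    show "\<forall>z. z \<notin> S \<longrightarrow> winding_number (rectpath a1 a3) z = 0"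
    proof (intro allI impI winding_number_rectpath_outside)
      fix z assume "z \<notin> S"
      then show "z \<notin> cbox a1 a3"
        using in_S[of z] by (auto simp: in_cbox_complex_iff a_defs)
    qed (use R in \<open>auto simp: a_defs\<close>)
  qed (use path_im in auto)
  moreover have "winding_number (rectpath a1 a3) p = 1"
    using R by (intro winding_number_rectpath) (auto simp: in_box_complex_iff a_defs p_def)
  ultimately have "contour_integral (rectpath a1 a3) F = 2 * pi * \<i> * residue F p"
    by simp
  also have "\<dots> = 2 * pi * exp (- pi * t / 2)"
  proof -
    have "2 * pi * \<i> * (complex_of_real E / \<i>) = 2 * pi * E" for E
      by simp
    then show ?thesis unfolding res .
  qed
  finally have total: "contour_integral (rectpath a1 a3) F = 2 * pi * exp (- pi * t / 2)" .

  have rect: "rectpath a1 a3 = linepath a1 a2 +++ linepath a2 a3 +++ linepath a3 a4 +++ linepath a4 a1"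
  proof -
    have "Complex (Re a3) (Im a1) = a2" "Complex (Re a1) (Im a3) = a4"
      by (simp_all add: a_defs complex_eq_iff)
    then show ?thesis by (simp add: rectpath_def Let_def)
  qed
  have seg: "closed_segment a1 a2 \<subseteq> S - {p}" "closed_segment a2 a3 \<subseteq> S - {p}"
            "closed_segment a3 a4 \<subseteq> S - {p}" "closed_segment a4 a1 \<subseteq> S - {p}"
    using path_im unfolding rect by (auto simp: path_image_join)
  have F_int: "F contour_integrable_on linepath a b" if "closed_segment a b \<subseteq> S - {p}" for a b
    by (intro contour_integrable_continuous_linepath holomorphic_on_imp_continuous_on
          holomorphic_on_subset[OF F_holo] that)
  define J where "J = contour_integral (linepath a1 a2) F"
  have sum: "contour_integral (rectpath a1 a3) F = J + contour_integral (linepath a2 a3) F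
      + contour_integral (linepath a3 a4) F + contour_integral (linepath a4 a1) F"
    unfolding rect J_def using F_int seg by (simp add: contour_integrable_join)

  have shift: "F (z + \<i> * pi) = - exp (- pi * t) * F z" for z
  proof -
    have [simp]: "exp (\<i> * complex_of_real pi) = - 1" "exp (- (\<i> * complex_of_real pi)) = - 1"
      by (simp_all add: exp_minus)
    have "cosh (z + \<i> * pi) = - cosh z"
      by (simp add: cosh_field_def exp_add exp_diff exp_minus field_simps)
    moreover have "exp (\<i> * of_real t * (z + \<i> * pi)) = exp (\<i> * of_real t * z) * exp (- pi * t)"
    proof -
      have "\<i> * of_real t * (z + \<i> * pi) = \<i> * of_real t * z + of_real (- pi * t)"
        by (simp add: complex_eq_iff algebra_simps)
      then show ?thesis
        by (simp only: exp_add exp_of_real)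
    qed
    ultimately show ?thesis
      by (simp add: F_def)
  qed
  have top: "contour_integral (linepath a3 a4) F = exp (- pi * t) * J"
  proof -
    have "(F has_contour_integral J) (linepath a1 a2)"
      unfolding J_def by (intro has_contour_integral_integral F_int seg)
    then have "((\<lambda>x. F (linepath a1 a2 x) * (a2 - a1)) has_integral J) {0..1}"
      by (simp add: has_contour_integral_linepath)
    then have "((\<lambda>x. - exp (- pi * t) * (F (linepath a1 a2 x) * (a2 - a1))) has_integral - exp (- pi * t) * J) {0..1}"
      by (rule has_integral_mult_right)
    moreover have "- exp (- pi * t) * (F (linepath a1 a2 x) * (a2 - a1)) = F (linepath a4 a3 x) * (a3 - a4)" for x
    proof -
      have "linepath a4 a3 x = linepath a1 a2 x + \<i> * pi" "a3 - a4 = a2 - a1"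
        by (auto simp: a_defs linepath_def complex_eq_iff algebra_simps)
      then show ?thesis by (simp add: shift)
    qed
    ultimately have "(F has_contour_integral - exp (- pi * t) * J) (linepath a4 a3)"
      by (simp add: has_contour_integral_linepath)
    from has_contour_integral_reverse_linepath[OF this] show ?thesis
      by (simp add: contour_integral_unique)
  qed
  have side: "norm (contour_integral (linepath a b) F) \<le> exp (pi * \<bar>t\<bar>) / sinh R * pi"
    if ab: "closed_segment a b \<subseteq> S - {p}" "Re a = Re b" "\<bar>Re a\<bar> = R" "norm (b - a) = pi"
       "Im a \<in> {0..pi}" "Im b \<in> {0..pi}" for a b
    unfolding that(4)[symmetric]
  proof (rule contour_integral_bound_linepath[OF F_int[OF ab(1)]])
    fix z assume "z \<in> closed_segment a b"
    then have z: "Re z = Re a" "Im z \<in> closed_segment (Im a) (Im b)"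
      using ab(2) by (auto simp: closed_segment_same_Re)
    then have Im: "0 \<le> Im z" "Im z \<le> pi"
      using ab(5,6) by (auto simp: closed_segment_eq_real_ivl split: if_splits)
    have "- (t * Im z) \<le> \<bar>t\<bar> * \<bar>Im z\<bar>"
      by (metis abs_ge_minus_self abs_mult)
    also have "\<dots> \<le> \<bar>t\<bar> * pi"
      using Im by (intro mult_left_mono) auto
    finally have "norm (exp (\<i> * of_real t * z)) \<le> exp (norm (b - a) * \<bar>t\<bar>)"
      using ab(4) by (simp add: mult.commute)
    moreover have "sinh R \<le> norm (cosh z)"
      using norm_cosh_ge_sinh[of z] unfolding z(1) ab(3) .
    ultimately show "norm (F z) \<le> exp (norm (b - a) * \<bar>t\<bar>) / sinh R"
      unfolding F_def norm_divide using R by (intro frac_le) auto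
  qed (use R in auto)
  have "norm (contour_integral (linepath a2 a3) F) \<le> exp (pi * \<bar>t\<bar>) / sinh R * pi"
       "norm (contour_integral (linepath a4 a1) F) \<le> exp (pi * \<bar>t\<bar>) / sinh R * pi"
    by (rule side[OF seg(2)]; use R in \<open>simp add: a_defs norm_complex_def\<close>)
       (rule side[OF seg(4)]; use R in \<open>simp add: a_defs norm_complex_def\<close>)
  moreover have "J * (1 + exp (- pi * t)) - 2 * pi * exp (- pi * t / 2)
      = - (contour_integral (linepath a2 a3) F + contour_integral (linepath a4 a1) F)"
    using total sum top by (simp add: algebra_simps add_eq_0_iff)
  ultimately have "norm (J * (1 + exp (- pi * t)) - 2 * pi * exp (- pi * t / 2))
      \<le> exp (pi * \<bar>t\<bar>) / sinh R * pi + exp (pi * \<bar>t\<bar>) / sinh R * pi"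
    by (metis add_mono norm_minus_cancel norm_triangle_le)
  then show ?thesis
    by (simp add: J_def a_defs)
qed

lemma sech_Fourier_transform:
  "(\<integral>x. iexp (t * x) / complex_of_real (cosh x) \<partial>lborel) = complex_of_real (pi / cosh (pi * t / 2))"
proof -
  define F :: "complex \<Rightarrow> complex" where "F z = exp (\<i> * of_real t * z) / cosh z" for z
  define G where "G x = iexp (t * x) / complex_of_real (cosh x)" for x
  define J where "J R = contour_integral (linepath (- of_real R) (of_real R)) F" for R
  have FG: "F (of_real x) = G x" for x
    by (simp add: F_def G_def cosh_field_def mult.assoc flip: exp_of_real)
  have G_norm: "norm (G x) = 1 / cosh x" for x
    by (simp add: G_def norm_divide)
  have G_meas: "G \<in> borel_measurable borel"
    unfolding G_def
    by (intro borel_measurable_continuous_onI continuous_intros) auto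
  have G_int: "integrable lborel G"
    using integrable_sech by (rule Bochner_Integration.integrable_bound) (auto simp: G_norm G_meas)
  have J_eq: "J R = (\<integral>x. indicator {-R..R} x *\<^sub>R G x \<partial>lborel)" if "R > 0" for R
  proof -
    have "J R = integral {-R..R} G"
      unfolding J_def using that by (subst contour_integral_linepath_Reals_eq) (auto simp: FG)
    moreover have "set_integrable lborel {-R..R} G"
      unfolding set_integrable_def using G_int by (intro integrable_mult_indicator) auto
    ultimately show ?thesis
      by (simp flip: set_borel_integral_eq_integral(2) add: set_lebesgue_integral_def)
  qed
  have "((\<lambda>R. \<integral>x. indicator {-R..R} x *\<^sub>R G x \<partial>lborel) \<longlongrightarrow> integral\<^sup>L lborel G) at_top"
  proof (rule integral_dominated_convergence_at_top[OF _ _ integrable_sech])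
    show "AE x in lborel. ((\<lambda>R. indicator {-R..R} x *\<^sub>R G x) \<longlongrightarrow> G x) at_top"
    proof (rule AE_I2)
      fix x :: real
      have "\<forall>\<^sub>F R in at_top. indicator {-R..R} x *\<^sub>R G x = G x"
        using eventually_ge_at_top[of "\<bar>x\<bar>"] by eventually_elim (auto simp: indicator_def abs_le_iff)
      then show "((\<lambda>R. indicator {-R..R} x *\<^sub>R G x) \<longlongrightarrow> G x) at_top"
        by (rule tendsto_eventually)
    qed
  qed (use G_int in \<open>auto simp: G_norm indicator_def\<close>)
  moreover have "\<forall>\<^sub>F R in at_top. (\<integral>x. indicator {-R..R} x *\<^sub>R G x \<partial>lborel) = J R"
    using eventually_gt_at_top[of 0] by eventually_elim (simp add: J_eq)
  ultimately have "(J \<longlongrightarrow> integral\<^sup>L lborel G) at_top"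
    by (rule Lim_transform_eventually)
  then have "((\<lambda>R. J R * (1 + exp (- pi * t)) - 2 * pi * exp (- pi * t / 2)) \<longlongrightarrow>
      integral\<^sup>L lborel G * (1 + exp (- pi * t)) - 2 * pi * exp (- pi * t / 2)) at_top"
    by (intro tendsto_intros)
  moreover have "((\<lambda>R. J R * (1 + exp (- pi * t)) - 2 * pi * exp (- pi * t / 2)) \<longlongrightarrow> 0) at_top"
  proof (rule Lim_null_comparison)
    show "\<forall>\<^sub>F R in at_top. norm (J R * (1 + exp (- pi * t)) - 2 * pi * exp (- pi * t / 2))
        \<le> 2 * pi * exp (pi * \<bar>t\<bar>) / sinh R"
      using eventually_gt_at_top[of 0]
      by eventually_elim (use sech_contour_integral in \<open>simp add: J_def F_def[abs_def]\<close>)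
    show "((\<lambda>R. 2 * pi * exp (pi * \<bar>t\<bar>) / sinh R) \<longlongrightarrow> 0) at_top"
      by (rule tendsto_divide_0[OF tendsto_const filterlim_at_top_imp_at_infinity[OF sinh_real_at_top]])
  qed
  ultimately have "integral\<^sup>L lborel G * (1 + exp (- pi * t)) - 2 * pi * exp (- pi * t / 2) = 0"
    by (rule tendsto_unique[OF trivial_limit_at_top_linorder])
  then have eq: "integral\<^sup>L lborel G * complex_of_real (1 + exp (- pi * t)) = complex_of_real (2 * pi * exp (- pi * t / 2))"
    by simp
  have "1 + exp (- pi * t) = 2 * exp (- pi * t / 2) * cosh (pi * t / 2)"
    by (simp add: cosh_field_def algebra_simps flip: exp_add)
  then have "integral\<^sup>L lborel G = complex_of_real (pi / cosh (pi * t / 2))"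
    using eq by (simp add: field_simps)
  then show ?thesis
    by (simp add: G_def[abs_def])
qed

section \<open>The characteristic function of the hyperbolic secant distributions\<close>

lemma
  assumes "a > 0"
  shows prob_space_hyperbolic_secant: "prob_space (density lborel (\<lambda>x. ennreal (hyperbolic_secant_density a x)))"
    and char_hyperbolic_secant:
      "char (density lborel (\<lambda>x. ennreal (hyperbolic_secant_density a x))) t
         = complex_of_real (1 / cosh (pi * a * t / 2))"
proof -
  let ?h = "hyperbolic_secant_density a"
  have [measurable]: "?h \<in> borel_measurable borel"
    unfolding hyperbolic_secant_density_def
    by (intro borel_measurable_continuous_onI continuous_intros) (use assms in auto)
  have h_nonneg: "0 \<le> ?h x" for x
    using assms by (simp add: hyperbolic_secant_density_def)
  have fourier: "(\<integral>x. ?h x *\<^sub>R iexp (t * x) \<partial>lborel) = complex_of_real (1 / cosh (pi * a * t / 2))" for t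
  proof -
    have "(\<integral>x. ?h x *\<^sub>R iexp (t * x) \<partial>lborel)
      = \<bar>a\<bar> *\<^sub>R (\<integral>x. ?h (0 + a * x) *\<^sub>R iexp (t * (0 + a * x)) \<partial>lborel)"
      using assms by (intro lborel_integral_real_affine) auto
    also have "(\<lambda>x. ?h (0 + a * x) *\<^sub>R iexp (t * (0 + a * x)))
        = (\<lambda>x. (1 / (pi * a)) *\<^sub>R (iexp (t * a * x) / complex_of_real (cosh x)))"
      using assms by (auto simp: hyperbolic_secant_density_def scaleR_conv_of_real mult_ac)
    also have "(\<integral>x. (1 / (pi * a)) *\<^sub>R (iexp (t * a * x) / complex_of_real (cosh x)) \<partial>lborel)
        = (1 / (pi * a)) *\<^sub>R complex_of_real (pi / cosh (pi * (t * a) / 2))"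
      by (subst integral_scaleR_right) (simp only: sech_Fourier_transform)
    finally show ?thesis
      using assms by (simp add: scaleR_conv_of_real mult_ac)
  qed
  have h_int: "integrable lborel ?h"
  proof -
    have "integrable lborel (\<lambda>x. (1 / (pi * a)) * (1 / cosh (0 + (1 / a) * x)))"
      using assms by (intro integrable_mult_right lborel_integrable_real_affine[OF integrable_sech]) auto
    then show ?thesis
      by (simp add: hyperbolic_secant_density_def[abs_def])
  qed
  have h_total: "(\<integral>x. ?h x \<partial>lborel) = 1"
  proof -
    have "complex_of_real (\<integral>x. ?h x \<partial>lborel) = 1"
      using fourier[of 0] by (simp add: scaleR_conv_of_real integral_complex_of_real)
    then show ?thesis by simp
  qed
  show "prob_space (density lborel (\<lambda>x. ennreal (?h x)))"
  proof
    have "emeasure (density lborel (\<lambda>x. ennreal (?h x))) UNIV = ennreal (\<integral>x. ?h x \<partial>lborel)"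
      by (simp add: emeasure_density nn_integral_eq_integral h_int h_nonneg)
    then show "emeasure (density lborel (\<lambda>x. ennreal (?h x))) (space (density lborel (\<lambda>x. ennreal (?h x)))) = 1"
      by (simp add: h_total)
  qed
  show "char (density lborel (\<lambda>x. ennreal (?h x))) t = complex_of_real (1 / cosh (pi * a * t / 2))"
    unfolding char_def fourier[symmetric] by (subst integral_density) (auto simp: h_nonneg)
qed

text \<open>
  The parameters are related by \<open>c = \<pi> a / 2\<close>.
\<close>

lemma (in prob_space) hyperbolic_secant_distribution_iff_char:
  assumes X [measurable]: "X \<in> borel_measurable M"
  shows "hyperbolic_secant_distribution M X \<longleftrightarrow>
    (\<exists>c>0. \<forall>t. char (distr M borel X) t = complex_of_real (1 / cosh (c * t)))"
proof
  assume "hyperbolic_secant_distribution M X"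
  then obtain a where a: "a > 0" and "distr M lborel X = density lborel (\<lambda>x. ennreal (hyperbolic_secant_density a x))"
    by (auto simp: hyperbolic_secant_distribution_def distributed_def)
  moreover have "distr M borel X = distr M lborel X"
    by (rule distr_cong) auto
  ultimately have "char (distr M borel X) t = complex_of_real (1 / cosh (pi * a / 2 * t))" for t
    using char_hyperbolic_secant[OF a, of t] by (simp add: mult_ac)
  then show "\<exists>c>0. \<forall>t. char (distr M borel X) t = complex_of_real (1 / cosh (c * t))"
    using a by (intro exI[of _ "pi * a / 2"]) auto
next
  assume "\<exists>c>0. \<forall>t. char (distr M borel X) t = complex_of_real (1 / cosh (c * t))"
  then obtain c where c: "c > 0" and char_X: "\<And>t. char (distr M borel X) t = complex_of_real (1 / cosh (c * t))"
    by blast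
  define a where "a = 2 * c / pi"
  have a: "a > 0" using c by (simp add: a_def)
  let ?D = "density lborel (\<lambda>x. ennreal (hyperbolic_secant_density a x))"
  have meas: "hyperbolic_secant_density a \<in> borel_measurable borel"
    unfolding hyperbolic_secant_density_def
    by (intro borel_measurable_continuous_onI continuous_intros) (use a in auto)
  have "distr M borel X = ?D"
  proof (rule Levy_uniqueness)
    show "real_distribution (distr M borel X)"
      by (rule real_distribution_distr) measurable
    show "real_distribution ?D"
      by (intro real_distribution.intro prob_space_hyperbolic_secant[OF a] real_distribution_axioms.intro) auto
    show "char (distr M borel X) = char ?D"
      by (intro ext) (simp only: char_X char_hyperbolic_secant[OF a], simp add: a_def)
  qed
  moreover have "distr M borel X = distr M lborel X"
    by (rule distr_cong) auto
  ultimately have "distributed M lborel X (\<lambda>x. ennreal (hyperbolic_secant_density a x))"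
    using meas by (auto simp: distributed_def)
  then show "hyperbolic_secant_distribution M X"
    using a by (auto simp: hyperbolic_secant_distribution_def)
qed

section \<open>The two random linear forms\<close>

text \<open>
  Conditionally on \<open>\<epsilon> = 1\<close> and on \<open>\<epsilon> = 0\<close> the combination \<open>s L\<^sub>1 + t L\<^sub>2\<close> is an ordinary linear form
  in the three variables; the two forms differ only in the coefficient of \<open>X\<^sub>3\<close>, which is
  \<open>s\<close> or \<open>t\<close>. This produces the average of \<open>f s\<close> and \<open>f t\<close>.
\<close>

lemma (in prob_space) char_random_linear_forms:
  fixes X :: "nat \<Rightarrow> 'a \<Rightarrow> real" and \<epsilon> :: "'a \<Rightarrow> real"
  assumes X_indep: "indep_vars (\<lambda>_. borel) X {1, 2, 3}"
    and X_ident: "\<And>i. i \<in> {1, 2, 3} \<Longrightarrow> distr M borel (X i) = distr M borel (X 1)"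
    and eps: "fair_bernoulli M \<epsilon>"
    and eps_indep: "indep_rv M borel \<epsilon>
          (borel \<Otimes>\<^sub>M borel \<Otimes>\<^sub>M borel) (\<lambda>\<omega>. (X 1 \<omega>, X 2 \<omega>, X 3 \<omega>))"
  defines "f \<equiv> char (distr M borel (X 1))"
  shows "(\<integral>\<omega>. iexp (s * ((X 1 \<omega> + X 2 \<omega>) / 2 + \<epsilon> \<omega> * X 3 \<omega>)
              + t * ((X 1 \<omega> - X 2 \<omega>) / 2 + (1 - \<epsilon> \<omega>) * X 3 \<omega>)) \<partial>M)
    = f ((s + t) / 2) * f ((s - t) / 2) * ((f s + f t) / 2)"
proof -
  have X [measurable]: "X 1 \<in> borel_measurable M" "X 2 \<in> borel_measurable M" "X 3 \<in> borel_measurable M"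
    using X_indep by (auto simp: indep_vars_def)
  have [measurable]: "\<epsilon> \<in> borel_measurable M"
    using eps by (auto simp: fair_bernoulli_def)
  have three: "(\<integral>\<omega>. iexp (a * X 1 \<omega> + b * X 2 \<omega> + c * X 3 \<omega>) \<partial>M) = f a * f b * f c" for a b c
  proof -
    define u where "u i = (if i = 1 then a else if i = 2 then b else c)" for i :: nat
    have "indep_vars (\<lambda>_. borel) (\<lambda>i \<omega>. iexp (u i * X i \<omega>)) {1, 2, 3}"
      by (rule indep_vars_compose2[OF X_indep]) auto
    then have "(\<integral>\<omega>. (\<Prod>i\<in>{1, 2, 3}. iexp (u i * X i \<omega>)) \<partial>M) = (\<Prod>i\<in>{1, 2, 3}. \<integral>\<omega>. iexp (u i * X i \<omega>) \<partial>M)"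
      using X by (intro indep_vars_lebesgue_integral) (auto intro!: integrable_const_bound[where B = 1])
    also have "\<dots> = (\<Prod>i\<in>{1, 2, 3}. f (u i))"
    proof (rule prod.cong)
      fix i :: nat assume i: "i \<in> {1, 2, 3}"
      with X have "X i \<in> borel_measurable M" by auto
      from char_eq_expectation[OF this] X_ident[OF i]
      show "(\<integral>\<omega>. iexp (u i * X i \<omega>) \<partial>M) = f (u i)" by (simp add: f_def)
    qed simp
    finally show ?thesis
      by (simp add: u_def exp_add distrib_left mult_ac)
  qed
  have half: "(\<integral>\<omega>. indicator {e} (\<epsilon> \<omega>) * iexp (a * X 1 \<omega> + b * X 2 \<omega> + c * X 3 \<omega>) \<partial>M) = f a * f b * f c / 2"
    and half_int: "integrable M (\<lambda>\<omega>. indicator {e} (\<epsilon> \<omega>) * iexp (a * X 1 \<omega> + b * X 2 \<omega> + c * X 3 \<omega>))"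
    if e: "e \<in> {0, 1}" for e :: real and a b c
  proof -
    show int: "integrable M (\<lambda>\<omega>. indicator {e} (\<epsilon> \<omega>) * iexp (a * X 1 \<omega> + b * X 2 \<omega> + c * X 3 \<omega>))"
    proof (rule integrable_const_bound[where B = 1])
      show "AE \<omega> in M. norm (indicator {e} (\<epsilon> \<omega>) * iexp (a * X 1 \<omega> + b * X 2 \<omega> + c * X 3 \<omega>)) \<le> 1"
        by (intro AE_I2) (auto simp: norm_mult indicator_def)
    qed measurable
    have int_ind: "integrable M (\<lambda>\<omega>. indicator {e} (\<epsilon> \<omega>) :: complex)"
    proof (rule integrable_const_bound[where B = 1])
      show "AE \<omega> in M. norm (indicator {e} (\<epsilon> \<omega>) :: complex) \<le> 1"
        by (intro AE_I2) (auto simp: indicator_def)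
    qed measurable
    have int_iexp: "integrable M (\<lambda>\<omega>. iexp (a * X 1 \<omega> + b * X 2 \<omega> + c * X 3 \<omega>))"
    proof (rule integrable_const_bound[where B = 1])
      show "AE \<omega> in M. norm (iexp (a * X 1 \<omega> + b * X 2 \<omega> + c * X 3 \<omega>)) \<le> 1"
        by (intro AE_I2) auto
    qed measurable
    have indep: "indep_var borel (\<lambda>\<omega>. indicator {e} (\<epsilon> \<omega>) :: complex)
        borel (\<lambda>\<omega>. (\<lambda>(x, y, z). iexp (a * x + b * y + c * z)) (X 1 \<omega>, X 2 \<omega>, X 3 \<omega>))"
      by (rule indep_rv_compose[OF eps_indep, of "indicator {e}"]) auto
    have "(\<integral>\<omega>. indicator {e} (\<epsilon> \<omega>) \<partial>M :: complex) = (\<integral>\<omega>. complex_of_real (indicator {\<omega> \<in> space M. \<epsilon> \<omega> = e} \<omega>) \<partial>M)"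
      by (intro Bochner_Integration.integral_cong) (auto simp: indicator_def)
    also have "\<dots> = complex_of_real (prob {\<omega> \<in> space M. \<epsilon> \<omega> = e})"
      by (subst integral_complex_of_real) simp
    also have "prob {\<omega> \<in> space M. \<epsilon> \<omega> = e} = 1 / 2"
      using eps e by (auto simp: fair_bernoulli_def)
    finally have "(\<integral>\<omega>. indicator {e} (\<epsilon> \<omega>) \<partial>M :: complex) = 1 / 2" by simp
    then show "(\<integral>\<omega>. indicator {e} (\<epsilon> \<omega>) * iexp (a * X 1 \<omega> + b * X 2 \<omega> + c * X 3 \<omega>) \<partial>M) = f a * f b * f c / 2"
      using indep_var_lebesgue_integral[OF indep] three[of a b c] int_ind int_iexp by simp
  qed
  have "AE \<omega> in M. \<epsilon> \<omega> = 1 \<or> \<epsilon> \<omega> = 0"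
  proof (rule AE_I_eq_1)
    have "prob {\<omega> \<in> space M. \<epsilon> \<omega> = 1 \<or> \<epsilon> \<omega> = 0}
        = prob ({\<omega> \<in> space M. \<epsilon> \<omega> = 1} \<union> {\<omega> \<in> space M. \<epsilon> \<omega> = 0})"
      by (intro arg_cong[where f = prob]) auto
    also have "\<dots> = 1"
      using eps by (subst finite_measure_Union) (auto simp: fair_bernoulli_def)
    finally show "emeasure M {\<omega> \<in> space M. \<epsilon> \<omega> = 1 \<or> \<epsilon> \<omega> = 0} = 1"
      by (simp add: emeasure_eq_measure)
  qed measurable
  then have "(\<integral>\<omega>. iexp (s * ((X 1 \<omega> + X 2 \<omega>) / 2 + \<epsilon> \<omega> * X 3 \<omega>)
              + t * ((X 1 \<omega> - X 2 \<omega>) / 2 + (1 - \<epsilon> \<omega>) * X 3 \<omega>)) \<partial>M)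
    = (\<integral>\<omega>. indicator {1} (\<epsilon> \<omega>) * iexp ((s + t) / 2 * X 1 \<omega> + (s - t) / 2 * X 2 \<omega> + s * X 3 \<omega>)
        + indicator {0} (\<epsilon> \<omega>) * iexp ((s + t) / 2 * X 1 \<omega> + (s - t) / 2 * X 2 \<omega> + t * X 3 \<omega>) \<partial>M)"
  proof (intro integral_cong_AE, goal_cases)
    case 3
    have "s * ((X 1 \<omega> + X 2 \<omega>) / 2) + t * ((X 1 \<omega> - X 2 \<omega>) / 2) = (s + t) / 2 * X 1 \<omega> + (s - t) / 2 * X 2 \<omega>" for \<omega>
      by (simp add: field_simps)
    with 3 show ?case
      by (auto simp: distrib_left add_ac)
  qed measurable
  also have "\<dots> = f ((s + t) / 2) * f ((s - t) / 2) * f s / 2 + f ((s + t) / 2) * f ((s - t) / 2) * f t / 2"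
    by (subst Bochner_Integration.integral_add) (simp_all only: half half_int insert_iff simp_thms)
  finally show ?thesis
    by (simp add: field_simps)
qed

theorem theorem3p2:
  fixes M :: "'a measure"
    and X :: "nat \<Rightarrow> 'a \<Rightarrow> real"
    and \<epsilon> :: "'a \<Rightarrow> real"
  assumes "prob_space M"
    and X_indep: "prob_space.indep_vars M (\<lambda>_. borel) X {1, 2, 3}"
    and X_ident: "\<And>i. i \<in> {1, 2, 3} \<Longrightarrow> distr M borel (X i) = distr M borel (X 1)"
    and X_symm: "symmetric_distribution M (X 1)"
    and X_nondeg: "nondegenerate M (X 1)"
    and eps: "fair_bernoulli M \<epsilon>"
    and eps_indep: "indep_rv M borel \<epsilon>
          (borel \<Otimes>\<^sub>M borel \<Otimes>\<^sub>M borel) (\<lambda>\<omega>. (X 1 \<omega>, X 2 \<omega>, X 3 \<omega>))"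
  shows "prob_space.indep_var M
           borel (\<lambda>\<omega>. (X 1 \<omega> + X 2 \<omega>) / 2 + \<epsilon> \<omega> * X 3 \<omega>)
           borel (\<lambda>\<omega>. (X 1 \<omega> - X 2 \<omega>) / 2 + (1 - \<epsilon> \<omega>) * X 3 \<omega>)
         \<longleftrightarrow> hyperbolic_secant_distribution M (X 1)"
proof -
  interpret prob_space M by fact
  define L1 L2 where "L1 \<omega> = (X 1 \<omega> + X 2 \<omega>) / 2 + \<epsilon> \<omega> * X 3 \<omega>"
    and "L2 \<omega> = (X 1 \<omega> - X 2 \<omega>) / 2 + (1 - \<epsilon> \<omega>) * X 3 \<omega>" for \<omega>
  have X [measurable]: "X 1 \<in> borel_measurable M" "X 2 \<in> borel_measurable M" "X 3 \<in> borel_measurable M"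
    using X_indep by (auto simp: indep_vars_def)
  have [measurable]: "\<epsilon> \<in> borel_measurable M"
    using eps by (auto simp: fair_bernoulli_def)
  have L_meas [measurable]: "L1 \<in> borel_measurable M" "L2 \<in> borel_measurable M"
    unfolding L1_def L2_def by measurable
  define f where "f = char (distr M borel (X 1))"
  define \<phi> where "\<phi> t = (\<integral>\<omega>. cos (t * X 1 \<omega>) \<partial>M)" for t
  have f_phi: "f t = complex_of_real (\<phi> t)" for t
    unfolding f_def \<phi>_def by (rule char_symmetric[OF X_symm])
  interpret D: real_distribution "distr M borel (X 1)"
    by (rule real_distribution_distr[OF X(1)])
  have phi_even: "\<phi> (- t) = \<phi> t" for t by (simp add: \<phi>_def)
  have phi_0: "\<phi> 0 = 1" by (simp add: \<phi>_def prob_space)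
  have phi_le: "\<phi> t \<le> 1" for t
    using D.cmod_char_le_1[of t] unfolding f_def[symmetric] f_phi by simp
  have phi_cont: "continuous_on UNIV \<phi>"
  proof -
    have "isCont (\<lambda>t. Re (f t)) t" for t
      using D.isCont_char[of t] unfolding f_def isCont_def by (rule tendsto_Re)
    then show ?thesis
      by (simp add: f_phi continuous_on_eq_continuous_at)
  qed

  have joint: "(\<integral>\<omega>. iexp (s * L1 \<omega> + t * L2 \<omega>) \<partial>M)
      = complex_of_real (\<phi> ((s + t) / 2) * \<phi> ((s - t) / 2) * ((\<phi> s + \<phi> t) / 2))" for s t
    using char_random_linear_forms[OF X_indep X_ident eps eps_indep, of s t]
    unfolding f_def[symmetric] f_phi L1_def[symmetric] L2_def[symmetric] by simp
  have char_L1: "(\<integral>\<omega>. iexp (s * L1 \<omega>) \<partial>M) = complex_of_real ((\<phi> (s / 2))\<^sup>2 * ((\<phi> s + 1) / 2))" for s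
    using joint[of s 0] by (simp add: phi_0 power2_eq_square)
  have char_L2: "(\<integral>\<omega>. iexp (t * L2 \<omega>) \<partial>M) = complex_of_real ((\<phi> (t / 2))\<^sup>2 * ((\<phi> t + 1) / 2))" for t
    using joint[of 0 t] phi_even[of "t / 2"] by (simp add: phi_0 power2_eq_square add.commute)

  have indep_iff: "indep_var borel L1 borel L2 \<longleftrightarrow>
    (\<forall>s t. \<phi> ((s + t) / 2) * \<phi> ((s - t) / 2) * ((\<phi> s + \<phi> t) / 2)
      = (\<phi> (s / 2))\<^sup>2 * ((\<phi> s + 1) / 2) * ((\<phi> (t / 2))\<^sup>2 * ((\<phi> t + 1) / 2)))" (is "_ \<longleftrightarrow> ?eq")
  proof
    assume indep: "indep_var borel L1 borel L2"
    show ?eq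
    proof (intro allI)
      fix s t
      have "indep_var borel ((\<lambda>x. iexp (s * x)) \<circ> L1) borel ((\<lambda>x. iexp (t * x)) \<circ> L2)"
        by (rule indep_var_compose[OF indep]) auto
      then have "(\<integral>\<omega>. iexp (s * L1 \<omega>) * iexp (t * L2 \<omega>) \<partial>M) = (\<integral>\<omega>. iexp (s * L1 \<omega>) \<partial>M) * (\<integral>\<omega>. iexp (t * L2 \<omega>) \<partial>M)"
        unfolding comp_def
        by (rule indep_var_lebesgue_integral) (auto intro!: integrable_const_bound[where B = 1])
      moreover have "(\<integral>\<omega>. iexp (s * L1 \<omega>) * iexp (t * L2 \<omega>) \<partial>M) = (\<integral>\<omega>. iexp (s * L1 \<omega> + t * L2 \<omega>) \<partial>M)"
        by (simp add: exp_add distrib_left)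
      ultimately have "(\<integral>\<omega>. iexp (s * L1 \<omega> + t * L2 \<omega>) \<partial>M)
          = (\<integral>\<omega>. iexp (s * L1 \<omega>) \<partial>M) * (\<integral>\<omega>. iexp (t * L2 \<omega>) \<partial>M)"
        by simp
      then show "\<phi> ((s + t) / 2) * \<phi> ((s - t) / 2) * ((\<phi> s + \<phi> t) / 2)
        = (\<phi> (s / 2))\<^sup>2 * ((\<phi> s + 1) / 2) * ((\<phi> (t / 2))\<^sup>2 * ((\<phi> t + 1) / 2))"
        unfolding joint char_L1 char_L2 of_real_mult[symmetric] of_real_eq_iff .
    qed
  next
    assume ?eq
    then show "indep_var borel L1 borel L2"
      by (intro indep_var_if_char_factors)
         (simp_all only: joint char_L1 char_L2 L_meas flip: of_real_mult)
  qed
  also have "\<dots> \<longleftrightarrow> (\<exists>c>0. \<forall>t. \<phi> t = 1 / cosh (c * t))"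
  proof
    assume eq: ?eq
    obtain c where c: "c \<ge> 0" "\<And>t. \<phi> t = 1 / cosh (c * t)"
      using functional_equation_imp_sech[OF phi_cont phi_0 phi_le] eq by blast
    \<comment> \<open>For \<open>c = 0\<close> the characteristic function is that of the point mass at \<open>0\<close>, which is
      excluded by nondegeneracy.\<close>
    have "c \<noteq> 0"
    proof
      assume "c = 0"
      have "distr M borel (X 1) = return borel 0"
      proof (rule Levy_uniqueness)
        show "real_distribution (return borel (0 :: real))"
          by (intro real_distribution.intro prob_space_return real_distribution_axioms.intro) auto
        show "char (distr M borel (X 1)) = char (return borel 0)"
        proof
          fix t
          have "char (distr M borel (X 1)) t = 1"
            unfolding f_def[symmetric] f_phi c(2) using \<open>c = 0\<close> by simp
          moreover have "char (return borel (0 :: real)) t = 1"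
            by (simp add: char_def integral_return)
          ultimately show "char (distr M borel (X 1)) t = char (return borel 0) t"
            by simp
        qed
      qed (rule D.real_distribution_axioms)
      moreover have "AE x in return borel (0 :: real). x = 0"
        by (subst AE_return) auto
      ultimately have "AE x in distr M borel (X 1). x = 0"
        by (simp only:)
      then have "AE \<omega> in M. X 1 \<omega> = 0"
        by (subst (asm) AE_distr_iff) (use X in auto)
      then show False
        using X_nondeg by (auto simp: nondegenerate_def)
    qed
    with c show "\<exists>c>0. \<forall>t. \<phi> t = 1 / cosh (c * t)"
      by (intro exI[of _ c]) auto
  next
    assume "\<exists>c>0. \<forall>t. \<phi> t = 1 / cosh (c * t)"
    then obtain c where c: "\<And>t. \<phi> t = 1 / cosh (c * t)" by blast
    show ?eq
    proof (intro allI)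
      fix s t
      define u v where "u = c * s / 2" and "v = c * t / 2"
      have double: "cosh (2 * x) + 1 = 2 * (cosh x)\<^sup>2" for x :: real
        by (simp add: cosh_double_cosh)
      have arg: "c * s = 2 * u" "c * t = 2 * v" "c * (s / 2) = u" "c * (t / 2) = v"
          "c * ((s + t) / 2) = u + v" "c * ((s - t) / 2) = u - v"
        by (simp_all add: u_def v_def field_simps)
      have marg: "(1 / cosh x)\<^sup>2 * ((1 / cosh (2 * x) + 1) / 2) = 1 / cosh (2 * x)" for x :: real
      proof -
        have "(1 / cosh x)\<^sup>2 * ((1 / cosh (2 * x) + 1) / 2) = (cosh (2 * x) + 1) / (2 * (cosh x)\<^sup>2 * cosh (2 * x))"
          by (simp add: field_simps)
        then show ?thesis unfolding double by simp
      qed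
      have "1 / cosh (2 * u) + 1 / cosh (2 * v) = (cosh (2 * u) + cosh (2 * v)) / (cosh (2 * u) * cosh (2 * v))"
        by (simp add: field_simps)
      also have "cosh (2 * u) + cosh (2 * v) = 2 * (cosh (u + v) * cosh (u - v))"
      proof -
        have "cosh ((u + v) + (u - v)) + cosh ((u + v) - (u - v)) = 2 * (cosh (u + v) * cosh (u - v))"
          unfolding cosh_add cosh_diff by simp
        then show ?thesis by simp
      qed
      finally show "\<phi> ((s + t) / 2) * \<phi> ((s - t) / 2) * ((\<phi> s + \<phi> t) / 2)
        = (\<phi> (s / 2))\<^sup>2 * ((\<phi> s + 1) / 2) * ((\<phi> (t / 2))\<^sup>2 * ((\<phi> t + 1) / 2))"
        unfolding c arg marg by simp
    qed
  qed
  also have "\<dots> \<longleftrightarrow> hyperbolic_secant_distribution M (X 1)"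
    unfolding hyperbolic_secant_distribution_iff_char[OF X(1)]
    by (simp only: f_def[symmetric] f_phi of_real_eq_iff)
  finally show ?thesis
    unfolding L1_def[abs_def] L2_def[abs_def] .
qed

end
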